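(* Let $D$ be a Dedekind domain, let $S$ be a nonempty subset of $D$, let $h\in\mathbb{N}\cup\{+\infty\}$ and $r\in\mathbb{N}$, and let $\mathcal{T}\subseteq\mathscr{I}(D)$, where $\mathscr{I}(D)$ is the set of all ideals of $D$. Then for integers $k,\ell\ge 0$ with $k+\ell<|S|$, the generalized binomial coefficient ${k+\ell\brack\ell}_{S,\mathcal{T}}^{h,\{r\}}$ (a priori a fractional ideal of $D$) is an integral ideal. That is, as integral ideals, $[k]!_{S,\mathcal{T}}^{h,\{r\}}\,[\ell]!_{S,\mathcal{T}}^{h,\{r\}}$ divides $[k+\ell]!_{S,\mathcal{T}}^{h,\{r\}}$.
   Context: $\mathbb{N}=\{0,1,2,\dots\}$. For an ideal $\mathfrak{b}$ of $D$, with $\mathfrak{b}^0=D$, put $v_{\mathfrak{b}}(a)=\sup\{k\in\mathbb{N}: aD\subseteq\mathfrak{b}^k\}\in\mathbb{N}\cup\{+\infty\}$ for $a\in D$. For a sequence $\mathbf{a}=(a_i)_{i=0}^\infty$ of elements of $S$ (repetitions allowed) define $$\alpha_n^{h,\{r\}}(S,\mathfrak{b},\mathbf{a})=\min_{A}\sum_{i\in A}\min\bigl(h,v_{\mathfrak{b}}(a_n-a_i)\bigr),$$ where $A$ ranges over all subsets of $\{0,\dots,n-1\}$ of cardinality $\max(n-r,0)$ (so the value is $0$ for $0\le n\le r$). The sequence $\mathbf{a}$ is an $r$-removed $\mathfrak{b}$-ordering of order $h$ of $S$ if $a_0,\dots,a_r\in S$ are arbitrary and, for every $n>r$, $a_n$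 attains the minimum over $s\in S$ of $\min_{A}\sum_{i\in A}\min(h,v_{\mathfrak{b}}(s-a_i))$, $A$ ranging over subsets of $\{0,\dots,n-1\}$ of cardinality $n-r$. In a Dedekind domain, the numbers $\alpha_n^{h,\{r\}}(S,\mathfrak{b},\mathbf{a})$ are the same for all $r$-removed $\mathfrak{b}$-orderings $\mathbf{a}$ of order $h$ of $S$; the common value is denoted $\alpha_n^{h,\{r\}}(S,\mathfrak{b})$. For $\mathcal{T}\subseteq\mathscr{I}(D)$ the $k$-th generalized factorial ideal is $$[k]!_{S,\mathcal{T}}^{h,\{r\}}=\prod_{\mathfrak{b}\in\mathcal{T}}\mathfrak{b}^{\alpha_k^{h,\{r\}}(S,\mathfrak{b})},$$ with conventions $\mathfrak{b}^0=(1)$ (including $(0)^0=(1)$), $\mathfrak{b}^{+\infty}=(0)$ for $\mathfrak{b}\neq(1)$, every power of $(1)$ equal to $(1)$, and the empty product equal to $(1)$. For $k<|S|$ only finitely many factors differ from the unit ideal $(1)=D$, and the product is a nonzero ideal. For $k,\ell\ge0$ with $k+\ell<|S|$ the generalized binomial coefficient is the fractional ideal $${k+\ell\brack\ell}_{S,\mathcal{T}}^{h,\{r\}}=\frac{[k+\ell]!_{S,\mathcal{T}}^{h,\{r\}}}{[k]!_{S,\mathcal{T}}^{h,\{r\}}\,[\ell]!_{S,\mathcal{T}}^{h,\{r\}}}.$$ *)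

theory Defs
  imports "HOL-Library.Extended_Nat" "HOL-Computational_Algebra.Computational_Algebra"
begin

text \<open>
  The Dedekind domain is a type \<open>'a\<close> of class \<^class>\<open>idom\<close> and its field of fractions is
  \<open>'a fract\<close>.  Ideals are the submodules of \<open>'a\<close> regarded as a module over itself.  They are
  turned into a type, so that \<open>b ^ n\<close>, \<open>\<Prod>\<close> and \<open>dvd\<close> for ideals are the generic ones and a set
  of ideals is an arbitrary term of type \<open>'a ideal set\<close>.
\<close>

subsection \<open>The monoid of ideals\<close>

lemma module_times: "module ((*) :: 'a::comm_ring_1 \<Rightarrow> 'a \<Rightarrow> 'a)"
  by unfold_locales (simp_all add: algebra_simps)

typedef (overloaded) 'a ideal = "{I :: 'a::comm_ring_1 set. module.subspace (*) I}"
  morphisms elts Abs_ideal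
  using module.subspace_UNIV[OF module_times] by blast

setup_lifting type_definition_ideal

instantiation ideal :: (comm_ring_1) "{zero, comm_monoid_mult}"
begin

lift_definition zero_ideal :: "'a ideal" is "{0}"
  by (rule module.subspace_single_0[OF module_times])

lift_definition one_ideal :: "'a ideal" is UNIV
  by (rule module.subspace_UNIV[OF module_times])

lift_definition times_ideal :: "'a ideal \<Rightarrow> 'a ideal \<Rightarrow> 'a ideal"
  is "\<lambda>I J. module.span (*) {a * b |a b. a \<in> I \<and> b \<in> J}"
  by (rule module.subspace_span[OF module_times])

instance
proof
  interpret M: module "(*) :: 'a \<Rightarrow> 'a \<Rightarrow> 'a"
    by (rule module_times)
  define P where "P I J = {a * b |a b. a \<in> I \<and> b \<in> J}" for I J :: "'a set"
  have P_comm: "P I J = P J I" for I J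
    unfolding P_def by (auto, (use mult.commute in blast)+)
  have left: "M.span (P (M.span A) B) \<subseteq> M.span (P A B)" for A B
  proof (rule M.span_minimal)
    show "P (M.span A) B \<subseteq> M.span (P A B)"
    proof
      fix z assume "z \<in> P (M.span A) B"
      then obtain x b where z: "z = x * b" and x: "x \<in> M.span A" and b: "b \<in> B"
        unfolding P_def by blast
      have "x * b \<in> M.span (P A B)"
      proof (rule M.span_induct_alt[OF x, of "\<lambda>x. x * b \<in> M.span (P A B)"])
        show "0 * b \<in> M.span (P A B)"
          by (simp add: M.span_zero)
      next
        fix c y w assume y: "y \<in> A" and w: "w * b \<in> M.span (P A B)"
        have "y * b \<in> P A B"
          unfolding P_def using y b by blast
        then have "c * (y * b) + w * b \<in> M.span (P A B)"
          by (intro M.span_add M.span_scale M.span_base w)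
        then show "(c * y + w) * b \<in> M.span (P A B)"
          by (simp only: distrib_right mult.assoc)
      qed
      then show "z \<in> M.span (P A B)" using z by simp
    qed
  qed (rule M.subspace_span)
  have span_left: "M.span (P (M.span A) B) = M.span (P A B)" for A B
  proof
    show "M.span (P A B) \<subseteq> M.span (P (M.span A) B)"
      by (rule M.span_mono) (use M.span_superset[of A] in \<open>auto simp: P_def\<close>)
  qed (rule left)
  have P_assoc: "P (P A B) C = P A (P B C)" for A B C
  proof
    show "P (P A B) C \<subseteq> P A (P B C)"
    proof
      fix z assume "z \<in> P (P A B) C"
      then obtain a b c where "z = a * b * c" "a \<in> A" "b \<in> B" "c \<in> C"
        unfolding P_def by blast
      then show "z \<in> P A (P B C)"
        unfolding P_def using mult.assoc[of a b c] by blast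
    qed
    show "P A (P B C) \<subseteq> P (P A B) C"
    proof
      fix z assume "z \<in> P A (P B C)"
      then obtain a b c where "z = a * (b * c)" "a \<in> A" "b \<in> B" "c \<in> C"
        unfolding P_def by blast
      then show "z \<in> P (P A B) C"
        unfolding P_def using mult.assoc[of a b c, symmetric] by blast
    qed
  qed
  have times: "elts (I * J) = M.span (P (elts I) (elts J))" for I J :: "'a ideal"
    unfolding P_def by (rule times_ideal.rep_eq)
  fix I J K :: "'a ideal"
  show comm: "I * J = J * I" for I J :: "'a ideal"
    by (simp add: elts_inject[symmetric] times P_comm)
  have "elts (I * J * K) = M.span (P (elts I) (P (elts J) (elts K)))"
    by (simp add: times span_left P_assoc)
  also have "P (elts I) (P (elts J) (elts K)) = P (P (elts J) (elts K)) (elts I)"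
    by (rule P_comm)
  also have "M.span \<dots> = elts (J * K * I)"
    by (simp only: times span_left)
  finally show "I * J * K = I * (J * K)"
    by (metis elts_inject comm)
  have sub: "M.subspace (elts I)"
    using elts by blast
  have "x \<in> P UNIV (elts I)" if "x \<in> elts I" for x
    unfolding P_def using that mult_1[of x, symmetric] by blast
  then have "P UNIV (elts I) = elts I"
    using M.subspace_scale[OF sub] unfolding P_def by blast
  then show "1 * I = I"
    using sub by (simp add: elts_inject[symmetric] times one_ideal.rep_eq M.span_eq_iff)
qed

end

subsection \<open>Dedekind domains\<close>

definition prime_ideal :: "'a::comm_ring_1 ideal \<Rightarrow> bool" where
  "prime_ideal P \<longleftrightarrow>
     elts P \<noteq> UNIV \<and> (\<forall>a b. a * b \<in> elts P \<longrightarrow> a \<in> elts P \<or> b \<in> elts P)"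

definition maximal_ideal :: "'a::comm_ring_1 ideal \<Rightarrow> bool" where
  "maximal_ideal P \<longleftrightarrow>
     elts P \<noteq> UNIV \<and> (\<forall>J. elts P \<subseteq> elts J \<longrightarrow> J = P \<or> elts J = UNIV)"

text \<open>
  A Noetherian integrally closed domain whose nonzero prime ideals are maximal.
  Fields are not excluded.
\<close>

definition dedekind_domain :: "'a::idom itself \<Rightarrow> bool" where
  "dedekind_domain _ \<longleftrightarrow>
     (\<forall>I :: 'a ideal. \<exists>B. finite B \<and> elts I = module.span (*) B) \<and>
     (\<forall>x :: 'a fract. (\<exists>p :: 'a poly. lead_coeff p = 1 \<and> poly (map_poly to_fract p) x = 0)
        \<longrightarrow> x \<in> range to_fract) \<and>
     (\<forall>P :: 'a ideal. prime_ideal P \<longrightarrow> P \<noteq> 0 \<longrightarrow> maximal_ideal P)"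

subsection \<open>Orderings\<close>

definition ideal_val :: "'a::comm_ring_1 ideal \<Rightarrow> 'a \<Rightarrow> enat" where
  "ideal_val b a = Sup {enat k |k. range ((*) a) \<subseteq> elts (b ^ k)}"

text \<open>
  The \<open>r\<close>-removed sum of a candidate \<open>s\<close> against \<open>a 0, \<dots>, a (n - 1)\<close>.  The subtraction \<open>n - r\<close>
  is truncated, so that the value is \<open>0\<close> for \<open>n \<le> r\<close>.
\<close>

definition removed_sum ::
    "enat \<Rightarrow> nat \<Rightarrow> 'a::comm_ring_1 ideal \<Rightarrow> (nat \<Rightarrow> 'a) \<Rightarrow> nat \<Rightarrow> 'a \<Rightarrow> enat" where
  "removed_sum h r b a n s =
     Min ((\<lambda>A. \<Sum>i\<in>A. min h (ideal_val b (s - a i))) ` {A. A \<subseteq> {..<n} \<and> card A = n - r})"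

definition removed_ordering ::
    "enat \<Rightarrow> nat \<Rightarrow> 'a::comm_ring_1 set \<Rightarrow> 'a ideal \<Rightarrow> (nat \<Rightarrow> 'a) \<Rightarrow> bool" where
  "removed_ordering h r S b a \<longleftrightarrow>
     (\<forall>i. a i \<in> S) \<and>
     (\<forall>n>r. \<forall>s\<in>S. removed_sum h r b a n (a n) \<le> removed_sum h r b a n s)"

definition alpha_seq ::
    "enat \<Rightarrow> nat \<Rightarrow> 'a::comm_ring_1 ideal \<Rightarrow> (nat \<Rightarrow> 'a) \<Rightarrow> nat \<Rightarrow> enat" where
  "alpha_seq h r b a n = removed_sum h r b a n (a n)"

text \<open>The common value of \<^const>\<open>alpha_seq\<close> on all orderings.\<close>

definition alpha :: "enat \<Rightarrow> nat \<Rightarrow> 'a::comm_ring_1 set \<Rightarrow> 'a ideal \<Rightarrow> nat \<Rightarrow> enat" where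
  "alpha h r S b n = (THE x. \<exists>a. removed_ordering h r S b a \<and> x = alpha_seq h r b a n)"

subsection \<open>Generalized factorials and binomial coefficients\<close>

definition ideal_epow :: "'a::comm_ring_1 ideal \<Rightarrow> enat \<Rightarrow> 'a ideal" where
  "ideal_epow b e = (case e of enat n \<Rightarrow> b ^ n | \<infinity> \<Rightarrow> if b = 1 then 1 else 0)"

text \<open>
  The product runs over the factors that differ from the unit ideal, because \<open>\<T>\<close> may be infinite
  and \<^const>\<open>prod\<close> over an infinite set is \<open>1\<close>.
\<close>

definition gen_fact ::
    "enat \<Rightarrow> nat \<Rightarrow> 'a::comm_ring_1 set \<Rightarrow> 'a ideal set \<Rightarrow> nat \<Rightarrow> 'a ideal" where
  "gen_fact h r S \<T> k =
     (\<Prod>b\<in>{b\<in>\<T>. ideal_epow b (alpha h r S b k) \<noteq> 1}. ideal_epow b (alpha h r S b k))"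

text \<open>Fractional ideals are represented as subsets of the field of fractions.\<close>

definition frac_of_ideal :: "'a::idom ideal \<Rightarrow> 'a fract set" where
  "frac_of_ideal I = to_fract ` elts I"

definition frac_times :: "'a::idom fract set \<Rightarrow> 'a fract set \<Rightarrow> 'a fract set" where
  "frac_times X Y =
     module.span (\<lambda>(d::'a) x. to_fract d * x) {x * y |x y. x \<in> X \<and> y \<in> Y}"

definition frac_inverse :: "'a::idom fract set \<Rightarrow> 'a fract set" where
  "frac_inverse X = {z. \<forall>x\<in>X. z * x \<in> range to_fract}"

definition integral_ideal :: "'a::idom fract set \<Rightarrow> bool" where
  "integral_ideal X \<longleftrightarrow> (\<exists>I. X = frac_of_ideal I)"

text \<open>\<open>gen_binom h r S \<T> n l\<close> is the coefficient with upper entry \<open>n\<close> and lower entry \<open>l\<close>.\<close>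

definition gen_binom ::
    "enat \<Rightarrow> nat \<Rightarrow> 'a::idom set \<Rightarrow> 'a ideal set \<Rightarrow> nat \<Rightarrow> nat \<Rightarrow> 'a fract set" where
  "gen_binom h r S \<T> n l =
     frac_times (frac_of_ideal (gen_fact h r S \<T> n))
       (frac_inverse (frac_of_ideal (gen_fact h r S \<T> (n - l) * gen_fact h r S \<T> l)))"

end

theory Submission
  imports Defs
begin

text \<open>
  The divisibility is proved one ideal \<open>b\<close> at a time, by showing that the exponents are superadditive:
  \<open>\<alpha>_k + \<alpha>_l \<le> \<alpha>_(k + l)\<close>.  What matters about the numbers \<open>min h (v_b (x - y))\<close> is that they
  are symmetric and satisfy the ultrametric inequality.  In that generality an \<open>r\<close>-removed ordering is
  a greedy sequence whose \<open>n\<close>-th term minimizes the sum of the valuations to its predecessors, the \<open>r\<close>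
  largest being dropped.

  The heart of the proof is a maximin property (\<open>greedy_maximin\<close>): for any \<open>n\<close> points
  \<open>b_0, \<dots>, b_(n-1)\<close> whatsoever there is \<open>s \<in> S\<close> whose cost against them is at most the cost \<open>\<alpha>_n\<close> of the
  \<open>n\<close>-th greedy term.  To find \<open>s\<close>, match the \<open>n\<close> points greedily with nearest points among
  \<open>a_0, \<dots>, a_n\<close>; the point \<open>a_t\<close> left over is no closer to any \<open>b_i\<close> than to the partner of \<open>b_i\<close>
  (\<open>nearest_matching\<close>), so its cost against the \<open>b_i\<close> is at most its cost against the other \<open>a_i\<close>, which in
  turn is at most \<open>\<alpha>_n\<close> (\<open>greedy_exchange\<close>).  Two greedy sequences compared in this way have equal
  costs, so \<open>\<alpha>_n\<close> is well defined.  Applied to the concatenation of \<open>a_0, \<dots>, a_(k-1)\<close> and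
  \<open>a_0, \<dots>, a_(l-1)\<close>, the property gives superadditivity, because dropping the \<open>r\<close> largest values of the union
  drops at most \<open>r\<close> from each part.

  It remains to see that the factorials really are products of all their nontrivial factors.  An ideal with
  \<open>\<alpha>_n > 0\<close> contains the nonzero product of the differences of any \<open>n + 1\<close> distinct elements of \<open>S\<close>, and in a
  Dedekind domain only finitely many ideals contain a given nonzero element (\<open>finite_ideals_above\<close>).  The latter is
  derived from the invertibility of nonzero prime ideals, \<open>P Q = (a)\<close>, by Noetherian induction.  Finally, the
  binomial coefficient is an integral ideal as soon as its numerator is contained in its denominator, which is a
  consequence of divisibility.
\<close>

section \<open>Sums with the largest terms removed\<close>

text \<open>
  The sum of all but the \<open>r\<close> largest values of \<open>f\<close> on \<open>I\<close>, and \<open>0\<close> if \<open>I\<close> has at most \<open>r\<close> elements.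
\<close>

definition trimmed_sum :: "nat \<Rightarrow> ('i \<Rightarrow> enat) \<Rightarrow> 'i set \<Rightarrow> enat" where
  "trimmed_sum r f I = Min (sum f ` {A. A \<subseteq> I \<and> card A = card I - r})"

lemma trimmed_sum_attained:
  assumes "finite I"
  obtains A where "A \<subseteq> I" "card A = card I - r" "trimmed_sum r f I = sum f A"
proof -
  obtain A0 where "A0 \<subseteq> I" "card A0 = card I - r"
    using obtain_subset_with_card_n[of "card I - r" I] by auto
  moreover have "finite {A. A \<subseteq> I \<and> card A = card I - r}"
    using assms by simp
  ultimately have "trimmed_sum r f I \<in> sum f ` {A. A \<subseteq> I \<and> card A = card I - r}"
    unfolding trimmed_sum_def by (intro Min_in) auto
  then show thesis using that by blast
qed

lemma trimmed_sum_le_sum: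
  assumes "finite I" "A \<subseteq> I" "card I - r \<le> card A"
  shows "trimmed_sum r f I \<le> sum f A"
proof -
  obtain B where B: "B \<subseteq> A" "card B = card I - r"
    using obtain_subset_with_card_n[OF assms(3)] by auto
  have "finite {A. A \<subseteq> I \<and> card A = card I - r}"
    using assms(1) by simp
  then have "trimmed_sum r f I \<le> sum f B"
    unfolding trimmed_sum_def using B assms(2) by (intro Min_le) auto
  also have "\<dots> \<le> sum f A"
    using B(1) assms(1,2) by (intro sum_mono2) (auto intro: finite_subset)
  finally show ?thesis .
qed

lemma trimmed_sum_eq_0: "finite I \<Longrightarrow> card I \<le> r \<Longrightarrow> trimmed_sum r f I = 0"
  using trimmed_sum_le_sum[of I "{}" r f] by simp

lemma trimmed_sum_bij_mono:
  assumes "finite I" "bij_betw \<sigma> I J" "\<And>i. i \<in> I \<Longrightarrow> f i \<le> g (\<sigma> i)"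
  shows "trimmed_sum r f I \<le> trimmed_sum r g J"
proof -
  have "finite J" "card J = card I"
    using assms(1,2) bij_betw_finite bij_betw_same_card by metis+
  then obtain B where B: "B \<subseteq> J" "card B = card I - r" "trimmed_sum r g J = sum g B"
    using trimmed_sum_attained[of J r g] by metis
  define A where "A = {i \<in> I. \<sigma> i \<in> B}"
  have A: "bij_betw \<sigma> A B"
    using assms(2) B(1) unfolding A_def bij_betw_def inj_on_def by auto
  have "trimmed_sum r f I \<le> sum f A"
    using B(2) bij_betw_same_card[OF A] assms(1) by (intro trimmed_sum_le_sum) (auto simp: A_def)
  also have "\<dots> \<le> (\<Sum>i\<in>A. g (\<sigma> i))"
    using assms(3) by (intro sum_mono) (auto simp: A_def)
  also have "\<dots> = sum g B"
    by (rule sum.reindex_bij_betw[OF A])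
  finally show ?thesis by (simp add: B(3))
qed

lemma trimmed_sum_bij_eq:
  assumes "finite I" "bij_betw \<sigma> I J" "\<And>i. i \<in> I \<Longrightarrow> f i = g (\<sigma> i)"
  shows "trimmed_sum r f I = trimmed_sum r g J"
proof (rule antisym)
  show "trimmed_sum r f I \<le> trimmed_sum r g J"
    using assms by (intro trimmed_sum_bij_mono) auto
  have inv: "bij_betw (inv_into I \<sigma>) J I"
    by (rule bij_betw_inv_into[OF assms(2)])
  show "trimmed_sum r g J \<le> trimmed_sum r f I"
  proof (rule trimmed_sum_bij_mono[OF _ inv])
    show "finite J" using assms(1,2) bij_betw_finite by blast
    show "g j \<le> f (inv_into I \<sigma> j)" if "j \<in> J" for j
      using assms(3)[of "inv_into I \<sigma> j"] bij_betw_inv_into_right[OF assms(2) that]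
        bij_betwE[OF inv] that by simp
  qed
qed

lemma trimmed_sum_mono_set:
  assumes "finite J" "I \<subseteq> J"
  shows "trimmed_sum r f I \<le> trimmed_sum r f J"
proof -
  obtain A where A: "A \<subseteq> J" "card A = card J - r" "trimmed_sum r f J = sum f A"
    using trimmed_sum_attained[OF assms(1)] by metis
  have fin: "finite A" using A(1) assms(1) finite_subset by blast
  have "A = (A \<inter> I) \<union> (A - I)" by blast
  then have "card A \<le> card (A \<inter> I) + card (A - I)"
    using card_Un_le[of "A \<inter> I" "A - I"] by simp
  moreover have "card (A - I) \<le> card (J - I)"
    using A(1) assms(1) by (intro card_mono) auto
  moreover have "card J = card I + card (J - I)"
    using assms by (simp add: card_Diff_subset card_mono finite_subset)
  ultimately have "card I - r \<le> card (A \<inter> I)"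
    using A(2) by linarith
  then have "trimmed_sum r f I \<le> sum f (A \<inter> I)"
    using assms finite_subset by (intro trimmed_sum_le_sum) auto
  also have "\<dots> \<le> sum f A"
    using fin by (intro sum_mono2) auto
  finally show ?thesis by (simp add: A(3))
qed

lemma trimmed_sum_zero_outside:
  assumes "finite J" "I \<subseteq> J" "\<And>i. i \<in> J - I \<Longrightarrow> f i = 0"
  shows "trimmed_sum r f J \<le> trimmed_sum r f I"
proof -
  have fin: "finite I" using assms finite_subset by blast
  obtain A where A: "A \<subseteq> I" "card A = card I - r" "trimmed_sum r f I = sum f A"
    using trimmed_sum_attained[OF fin] by metis
  have finA: "finite A" using A(1) fin finite_subset by blast
  have "card (A \<union> (J - I)) = card A + card (J - I)"
    using A(1) assms(1) finA by (intro card_Un_disjoint) auto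
  moreover have "card J = card I + card (J - I)"
    using assms by (simp add: card_Diff_subset card_mono finite_subset)
  ultimately have "trimmed_sum r f J \<le> sum f (A \<union> (J - I))"
    using A assms by (intro trimmed_sum_le_sum) auto
  also have "\<dots> = sum f A"
    using assms finA A(1) by (intro sum.mono_neutral_right) auto
  finally show ?thesis by (simp add: A(3))
qed

lemma trimmed_sum_Un_superadditive:
  assumes "finite I" "finite J" "I \<inter> J = {}"
  shows "trimmed_sum r f I + trimmed_sum r f J \<le> trimmed_sum r f (I \<union> J)"
proof -
  obtain A where A: "A \<subseteq> I \<union> J" "card A = card (I \<union> J) - r" "trimmed_sum r f (I \<union> J) = sum f A"
    using trimmed_sum_attained[of "I \<union> J"] assms by (metis finite_Un)
  have finA: "finite A" using A(1) assms finite_subset by blast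
  have split: "A = (A \<inter> I) \<union> (A \<inter> J)" using A(1) by blast
  have disj: "(A \<inter> I) \<inter> (A \<inter> J) = {}" using assms(3) by blast
  have "card A = card (A \<inter> I) + card (A \<inter> J)"
    using split disj finA by (metis card_Un_disjoint finite_Int)
  moreover have "card (I \<union> J) = card I + card J"
    using assms by (rule card_Un_disjoint)
  moreover have "card (A \<inter> I) \<le> card I" "card (A \<inter> J) \<le> card J"
    using assms by (auto intro: card_mono)
  ultimately have "card I - r \<le> card (A \<inter> I)" "card J - r \<le> card (A \<inter> J)"
    using A(2) by linarith+
  then have "trimmed_sum r f I \<le> sum f (A \<inter> I)" "trimmed_sum r f J \<le> sum f (A \<inter> J)"
    using assms by (auto intro!: trimmed_sum_le_sum)
  moreover have "sum f A = sum f (A \<inter> I) + sum f (A \<inter> J)"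
    using split disj finA by (metis finite_Int sum.union_disjoint)
  ultimately show ?thesis
    using A(3) by (simp add: add_mono)
qed

text \<open>
  Keeping the smallest values of \<open>f\<close> minimizes the sum over subsets of a fixed size, and the same
  choice remains minimal when \<open>f\<close> is composed with a monotone map.
\<close>

lemma obtain_lower_subset:
  fixes f :: "'i \<Rightarrow> 'b::linorder"
  assumes "finite I" "m \<le> card I"
  obtains A where "A \<subseteq> I" "card A = m" "\<And>x y. x \<in> A \<Longrightarrow> y \<in> I - A \<Longrightarrow> f x \<le> f y"
proof -
  have "\<exists>A\<subseteq>I. card A = m \<and> (\<forall>x\<in>A. \<forall>y\<in>I - A. f x \<le> f y)"
    using assms(2)
  proof (induction m)
    case 0
    then show ?case by (intro exI[of _ "{}"]) auto
  next
    case (Suc m)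
    then obtain A where A: "A \<subseteq> I" "card A = m" "\<forall>x\<in>A. \<forall>y\<in>I - A. f x \<le> f y"
      by auto
    have "I - A \<noteq> {}"
      using A Suc.prems assms(1) by (metis Diff_eq_empty_iff card_mono finite_subset not_less_eq_eq)
    then obtain z where z: "z \<in> I - A" "\<And>y. y \<in> I - A \<Longrightarrow> f z \<le> f y"
      using arg_min_if_finite[of "I - A" f] assms(1) by (metis finite_Diff not_le_imp_less)
    show ?case
      using A z finite_subset[OF A(1) assms(1)]
      by (intro exI[of _ "insert z A"]) auto
  qed
  then show thesis using that by blast
qed

lemma sum_lower_subset_le:
  fixes f :: "'i \<Rightarrow> enat"
  assumes "finite I" "A \<subseteq> I" "B \<subseteq> I" "card B = card A"
    and low: "\<And>x y. x \<in> A \<Longrightarrow> y \<in> I - A \<Longrightarrow> f x \<le> f y"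
  shows "sum f A \<le> sum f B"
proof -
  have fin: "finite A" "finite B" using assms finite_subset by blast+
  have "card (A - B) = card (B - A)"
    using fin assms(4) by (simp add: card_Diff_subset_Int Int_commute)
  then obtain \<tau> where \<tau>: "bij_betw \<tau> (A - B) (B - A)"
    using fin by (meson finite_Diff finite_same_card_bij)
  have "sum f (A - B) \<le> (\<Sum>i\<in>A - B. f (\<tau> i))"
    using bij_betwE[OF \<tau>] assms(3) by (intro sum_mono low) auto
  also have "\<dots> = sum f (B - A)"
    by (rule sum.reindex_bij_betw[OF \<tau>])
  finally have "sum f (A \<inter> B) + sum f (A - B) \<le> sum f (B \<inter> A) + sum f (B - A)"
    by (simp add: Int_commute add_left_mono)
  then show ?thesis
    using fin by (simp add: sum.Int_Diff[symmetric])
qed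

text \<open>
  Write \<open>f\<close> as its part below the level \<open>c\<close> plus its excess over \<open>c\<close>.  Both are monotone functions of \<open>f\<close>,
  so the same subset, the one carrying the smallest values of \<open>f\<close>, is minimal for \<open>f\<close> and for both
  parts.  For arbitrary summands, trimmed sums are only superadditive.
\<close>

lemma trimmed_sum_split_at:
  assumes "finite I"
  shows "trimmed_sum r f I = trimmed_sum r (\<lambda>i. min c (f i)) I + trimmed_sum r (\<lambda>i. f i - c) I"
proof -
  have split: "x = min c x + (x - c)" for x :: enat
    by (cases c; cases x) auto
  then have sum: "sum f A = (\<Sum>i\<in>A. min c (f i)) + (\<Sum>i\<in>A. f i - c)" for A
    by (metis (mono_tags, lifting) sum.cong sum.distrib)
  obtain A where A: "A \<subseteq> I" "card A = card I - r" and
    low: "\<And>x y. x \<in> A \<Longrightarrow> y \<in> I - A \<Longrightarrow> f x \<le> f y"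
    using obtain_lower_subset[OF assms diff_le_self, of r f] by blast
  have least: "trimmed_sum r (\<lambda>i. \<phi> (f i)) I = (\<Sum>i\<in>A. \<phi> (f i))" if "mono \<phi>" for \<phi> :: "enat \<Rightarrow> enat"
  proof (rule antisym)
    show "trimmed_sum r (\<lambda>i. \<phi> (f i)) I \<le> (\<Sum>i\<in>A. \<phi> (f i))"
      using A assms by (intro trimmed_sum_le_sum) auto
    obtain B where B: "B \<subseteq> I" "card B = card I - r" "trimmed_sum r (\<lambda>i. \<phi> (f i)) I = (\<Sum>i\<in>B. \<phi> (f i))"
      using trimmed_sum_attained[OF assms] by metis
    have "(\<Sum>i\<in>A. \<phi> (f i)) \<le> (\<Sum>i\<in>B. \<phi> (f i))"
      using A B assms monoD[OF that low] by (intro sum_lower_subset_le[of I]) auto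
    then show "(\<Sum>i\<in>A. \<phi> (f i)) \<le> trimmed_sum r (\<lambda>i. \<phi> (f i)) I" by (simp add: B(3))
  qed
  have "x - c \<le> y - c" if "x \<le> y" for x y :: enat
    using that by (cases c; cases x; cases y) auto
  then have "trimmed_sum r (\<lambda>i. f i - c) I = (\<Sum>i\<in>A. f i - c)"
    by (intro least monoI)
  moreover have "trimmed_sum r (\<lambda>i. min c (f i)) I = (\<Sum>i\<in>A. min c (f i))"
    by (intro least monoI) (auto simp: min_def)
  moreover have "trimmed_sum r f I = sum f A"
    by (rule least[OF monoI])
  ultimately show ?thesis by (simp only: sum[symmetric])
qed

section \<open>Orderings of sets with an ultrametric valuation\<close>

locale ultrametric =
  fixes w :: "'x \<Rightarrow> 'x \<Rightarrow> enat"
  assumes w_sym: "w x y = w y x"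
    and w_ultra: "min (w x y) (w y z) \<le> w x z"
begin

text \<open>
  In an ultrametric space the two smallest of the three valuations between three points are equal.
  Hence two points \<open>x\<close>, \<open>y\<close> cannot be told apart by valuations truncated at \<open>w x y\<close>.
\<close>

lemma min_w_eq: "min (w x y) (w x z) = min (w x y) (w y z)"
  using w_ultra[of x y z] w_ultra[of y x z] by (auto simp: w_sym[of y x] min_def split: if_splits)

definition cost :: "nat \<Rightarrow> ('i \<Rightarrow> 'x) \<Rightarrow> 'i set \<Rightarrow> 'x \<Rightarrow> enat" where
  "cost r a I s = trimmed_sum r (\<lambda>i. w s (a i)) I"

definition greedy :: "nat \<Rightarrow> 'x set \<Rightarrow> (nat \<Rightarrow> 'x) \<Rightarrow> bool" where
  "greedy r S a \<longleftrightarrow>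
     (\<forall>i. a i \<in> S) \<and> (\<forall>n>r. \<forall>s\<in>S. cost r a {..<n} (a n) \<le> cost r a {..<n} s)"

lemma greedy_cost_le:
  assumes "greedy r S a" "s \<in> S"
  shows "cost r a {..<n} (a n) \<le> cost r a {..<n} s"
  using assms by (cases "n > r") (auto simp: greedy_def cost_def trimmed_sum_eq_0)

lemma greedy_exists:
  assumes "S \<noteq> {}"
  shows "\<exists>a. greedy r S a"
proof -
  define P where "P a n s \<longleftrightarrow> s \<in> S \<and> (\<forall>s'\<in>S. cost r a {..<n} s \<le> cost r a {..<n} s')"
    for a :: "nat \<Rightarrow> 'x" and n s
  have "\<exists>a. \<forall>n. P a n (a n)"
  proof (rule dependent_wellorder_choice)
    show "P f n s = P g n s" if "\<And>m. m < n \<Longrightarrow> f m = g m" for f g n s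
    proof -
      have "cost r f {..<n} x = cost r g {..<n} x" for x
        unfolding cost_def using that by (intro trimmed_sum_bij_eq[of _ id]) (auto simp: bij_betw_def)
      then show ?thesis by (simp add: P_def)
    qed
    show "\<exists>s. P f n s" for f n
    proof -
      have "\<exists>v. \<exists>s\<in>S. cost r f {..<n} s = v" using assms by blast
      from LeastI_ex[OF this] obtain s where
        "s \<in> S" "cost r f {..<n} s = (LEAST v. \<exists>s\<in>S. cost r f {..<n} s = v)" by blast
      then show ?thesis
        unfolding P_def by (intro exI[of _ s]) (auto intro!: Least_le)
    qed
  qed
  then show ?thesis unfolding greedy_def P_def by blast
qed

text \<open>
  Match the points of \<open>b\<close>, one after the other, with a nearest point of \<open>a\<close> that is still free, and let \<open>a t\<close>
  be the point that is left over.  When \<open>b i\<close> was matched, \<open>a t\<close> was free as well, so \<open>b i\<close> is at least as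
  close to its partner as to \<open>a t\<close>; by the ultrametric inequality \<open>a t\<close> is then at least as close to that
  partner as to \<open>b i\<close>.
\<close>

lemma nearest_matching:
  assumes "finite I" "finite J" "card J = Suc (card I)"
  shows "\<exists>t\<in>J. \<exists>\<sigma>. bij_betw \<sigma> I (J - {t}) \<and> (\<forall>i\<in>I. w (a t) (b i) \<le> w (a t) (a (\<sigma> i)))"
  using assms
proof (induction I arbitrary: J rule: finite_induct)
  case empty
  then obtain t where "J = {t}" by (auto simp: card_1_singleton_iff)
  then show ?case by (auto simp: bij_betw_def)
next
  case (insert i I)
  let ?v = "\<lambda>x. w (b i) (a x)"
  have "J \<noteq> {}" using insert.prems by auto
  then have "Max (?v ` J) \<in> ?v ` J"
    using insert.prems(1) by (intro Max_in) auto
  then obtain j where jJ: "j \<in> J" and "?v j = Max (?v ` J)" by auto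
  then have j: "?v x \<le> ?v j" if "x \<in> J" for x
    using insert.prems(1) that by simp
  have "card (J - {j}) = Suc (card I)" using insert jJ by simp
  then obtain t \<sigma> where t: "t \<in> J - {j}" and \<sigma>: "bij_betw \<sigma> I (J - {j} - {t})"
    and le: "\<forall>x\<in>I. w (a t) (b x) \<le> w (a t) (a (\<sigma> x))"
    using insert.IH[of "J - {j}"] insert.prems(1) by auto
  define \<tau> where "\<tau> = \<sigma>(i := j)"
  have restr: "bij_betw \<tau> I (J - {j} - {t})"
  proof (rule bij_betw_cong[THEN iffD2, OF _ \<sigma>])
    show "\<tau> x = \<sigma> x" if "x \<in> I" for x
      using that insert.hyps(2) by (auto simp: \<tau>_def)
  qed
  have \<tau>_i: "\<tau> i = j" by (simp add: \<tau>_def)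
  have "bij_betw \<tau> (I \<union> {i}) ((J - {j} - {t}) \<union> {\<tau> i})"
    by (rule notIn_Un_bij_betw[OF insert.hyps(2) _ restr]) (simp add: \<tau>_i)
  moreover have "(J - {j} - {t}) \<union> {\<tau> i} = J - {t}" using t jJ \<tau>_i by auto
  ultimately have \<tau>: "bij_betw \<tau> (insert i I) (J - {t})" by simp
  have "w (a t) (b i) \<le> w (a t) (a j)"
    using w_ultra[of "a t" "b i" "a j"] j[of t] t by (auto simp: w_sym[of "a t" "b i"] min_def)
  then have "\<forall>x\<in>insert i I. w (a t) (b x) \<le> w (a t) (a (\<tau> x))"
    using le by (simp add: \<tau>_def)
  then show ?case using \<tau> t by blast
qed

text \<open>
  Among the first \<open>n + 1\<close> points of a greedy sequence the last one costs the most with respect to the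
  others.  Let \<open>c\<close> be the valuation between \<open>a t\<close> and \<open>a n\<close>.  Truncated at \<open>c\<close>, both costs agree, because the two
  points are indistinguishable up to that level, so only the excess over \<open>c\<close> matters.  The excess at
  \<open>a t\<close> comes from the points in the ball around \<open>a t\<close> of radius \<open>c\<close>; if \<open>a m\<close> is the last of them before
  \<open>a n\<close>, then the induction hypothesis for \<open>m\<close> and greediness (\<open>a n\<close> was an available choice for the
  \<open>m\<close>-th point) bound it.
\<close>

lemma greedy_exchange:
  assumes "greedy r S a" "t \<le> n"
  shows "cost r a ({..n} - {t}) (a t) \<le> cost r a {..<n} (a n)"
  using assms(2)
proof (induction n rule: less_induct)
  case (less n)
  show ?case
  proof (cases "t = n")
    case True
    then have "{..n} - {t} = {..<n}" by auto
    then show ?thesis using True by simp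
  next
    case False
    define c where "c = w (a t) (a n)"
    have trunc: "min c (w (a t) y) = min c (w (a n) y)" for y
      unfolding c_def by (rule min_w_eq)
    \<comment> \<open>The term of \<open>m\<close> on the left and the term of \<open>t\<close> on the right are both \<open>c\<close>; the others agree by \<open>trunc\<close>.\<close>
    have trunc_eq: "trimmed_sum r (\<lambda>i. min c (w (a t) (a i))) ({..m} - {t})
        = trimmed_sum r (\<lambda>i. min c (w (a n) (a i))) {..<m}" if "t \<le> m" "c \<le> w (a t) (a m)" for m
    proof (rule trimmed_sum_bij_eq[of _ "id(m := t)"])
      show "bij_betw (id(m := t)) ({..m} - {t}) {..<m}"
        using that(1) by (auto simp: bij_betw_def inj_on_def image_def split: if_splits)
      show "min c (w (a t) (a i)) = min c (w (a n) (a ((id(m := t)) i)))" if "i \<in> {..m} - {t}" for i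
        using \<open>c \<le> w (a t) (a m)\<close> trunc[of "a i"] by (auto simp: min_def c_def w_sym[of "a n" "a t"])
    qed simp
    show ?thesis
    proof (cases c)
      case infinity
      then show ?thesis
        using trunc_eq[of n] less.prems unfolding c_def cost_def by simp
    next
      case (enat c')
      define m where "m = Max {i. i < n \<and> c \<le> w (a t) (a i)}"
      have "c \<le> w (a t) (a t)"
        using w_ultra[of "a t" "a n" "a t"] by (simp add: c_def w_sym[of "a n"])
      then have tin: "t \<in> {i. i < n \<and> c \<le> w (a t) (a i)}"
        using False less.prems by simp
      then have "m \<in> {i. i < n \<and> c \<le> w (a t) (a i)}"
        unfolding m_def by (intro Max_in) auto
      then have m: "m < n" "c \<le> w (a t) (a m)" by auto
      have tm: "t \<le> m" unfolding m_def using tin by (intro Max_ge) auto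
      have beyond: "w (a t) (a i) < c" if "m < i" "i < n" for i
      proof (rule ccontr)
        assume "\<not> ?thesis"
        then have "i \<le> m" unfolding m_def using that by (intro Max_ge) auto
        then show False using that by simp
      qed
      \<comment> \<open>The part of the costs below level \<open>c\<close>; it is finite, so that it can be cancelled below.\<close>
      define E where "E = trimmed_sum r (\<lambda>i. min c (w (a n) (a i))) {..<m}"
      have "E \<le> (\<Sum>i<m. min c (w (a n) (a i)))"
        unfolding E_def by (intro trimmed_sum_le_sum) auto
      also have "\<dots> \<le> (\<Sum>i<m. c)" by (intro sum_mono) simp
      also have "\<dots> < \<infinity>" using enat by (simp add: of_nat_eq_enat)
      finally have fin: "E \<noteq> \<infinity>" by simp
      have "cost r a ({..m} - {t}) (a t) \<le> cost r a {..<m} (a m)"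
        by (rule less.IH[OF m(1) tm])
      also have "\<dots> \<le> cost r a {..<m} (a n)"
        using assms(1) by (intro greedy_cost_le) (auto simp: greedy_def)
      finally have "E + trimmed_sum r (\<lambda>i. w (a t) (a i) - c) ({..m} - {t})
          \<le> E + trimmed_sum r (\<lambda>i. w (a n) (a i) - c) {..<m}"
        unfolding cost_def E_def using trunc_eq[OF tm m(2)]
          trimmed_sum_split_at[of "{..m} - {t}" r "\<lambda>i. w (a t) (a i)" c]
          trimmed_sum_split_at[of "{..<m}" r "\<lambda>i. w (a n) (a i)" c] by simp
      then have "trimmed_sum r (\<lambda>i. w (a t) (a i) - c) ({..m} - {t})
          \<le> trimmed_sum r (\<lambda>i. w (a n) (a i) - c) {..<m}"
        using fin by (simp add: enat_add_left_cancel_le)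
      also have "\<dots> \<le> trimmed_sum r (\<lambda>i. w (a n) (a i) - c) {..<n}"
        using m(1) by (intro trimmed_sum_mono_set) auto
      finally have excess: "trimmed_sum r (\<lambda>i. w (a t) (a i) - c) ({..m} - {t})
          \<le> trimmed_sum r (\<lambda>i. w (a n) (a i) - c) {..<n}" .
      \<comment> \<open>Points later than \<open>a m\<close> lie outside the ball, or, like \<open>a n\<close>, on its boundary: no excess.\<close>
      have "x - c = 0" if "x \<le> c" for x
        using that enat by (cases x) (auto simp: zero_enat_def)
      then have "trimmed_sum r (\<lambda>i. w (a t) (a i) - c) ({..n} - {t})
          \<le> trimmed_sum r (\<lambda>i. w (a t) (a i) - c) ({..m} - {t})"
        using m(1) beyond c_def
        by (intro trimmed_sum_zero_outside) (auto simp: not_le le_less dest: less_imp_le)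
      then have "trimmed_sum r (\<lambda>i. w (a t) (a i) - c) ({..n} - {t})
          \<le> trimmed_sum r (\<lambda>i. w (a n) (a i) - c) {..<n}"
        using excess by (rule order_trans)
      then show ?thesis
        using trunc_eq[OF less.prems] c_def
          trimmed_sum_split_at[of "{..n} - {t}" r "\<lambda>i. w (a t) (a i)" c]
          trimmed_sum_split_at[of "{..<n}" r "\<lambda>i. w (a n) (a i)" c]
        unfolding cost_def by (simp add: add_left_mono)
    qed
  qed
qed

text \<open>
  A greedy sequence maximizes the cheapest cost over all families of \<open>n\<close> points.  This characterizes the
  minimal cost without reference to the sequence; both its independence of the choices made and its
  superadditivity follow.
\<close>

lemma greedy_maximin:
  assumes "greedy r S a"
  obtains s where "s \<in> S" "cost r b {..<n} s \<le> cost r a {..<n} (a n)"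
proof -
  obtain t \<sigma> where t: "t \<in> {..n}" and \<sigma>: "bij_betw \<sigma> {..<n} ({..n} - {t})"
    and le: "\<forall>i\<in>{..<n}. w (a t) (b i) \<le> w (a t) (a (\<sigma> i))"
    using nearest_matching[of "{..<n}" "{..n}" a b] unfolding card_atMost card_lessThan by blast
  have "cost r b {..<n} (a t) \<le> cost r a ({..n} - {t}) (a t)"
    unfolding cost_def using \<sigma> le by (intro trimmed_sum_bij_mono) auto
  also have "\<dots> \<le> cost r a {..<n} (a n)"
    using assms t by (intro greedy_exchange) auto
  finally show thesis using that[of "a t"] assms by (auto simp: greedy_def)
qed

lemma greedy_cost_unique:
  assumes "greedy r S a" "greedy r S b"
  shows "cost r a {..<n} (a n) = cost r b {..<n} (b n)"
proof -
  have "cost r b {..<n} (b n) \<le> cost r a {..<n} (a n)"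
    if ab: "greedy r S a" "greedy r S b" for a b
  proof -
    obtain s where "s \<in> S" "cost r b {..<n} s \<le> cost r a {..<n} (a n)"
      using greedy_maximin[OF ab(1), where b = b and n = n] by blast
    then show ?thesis
      using greedy_cost_le[OF ab(2), of s n] by (meson order_trans)
  qed
  then show ?thesis using assms by (intro antisym) auto
qed

text \<open>
  Concatenate the first \<open>k\<close> and the first \<open>l\<close> points of the sequence.  The cost of any \<open>s\<close> with respect to
  the concatenation is at least the sum of the two separate costs, and for some \<open>s\<close> it is at most the
  \<open>(k + l)\<close>-th minimal cost.
\<close>

lemma greedy_cost_superadditive:
  assumes "greedy r S a"
  shows "cost r a {..<k} (a k) + cost r a {..<l} (a l) \<le> cost r a {..<k + l} (a (k + l))"
proof -
  define b where "b i = (if i < k then a i else a (i - k))" for i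
  obtain s where s: "s \<in> S" "cost r b {..<k + l} s \<le> cost r a {..<k + l} (a (k + l))"
    using greedy_maximin[OF assms, where b = b and n = "k + l"] by blast
  have "cost r a {..<k} (a k) \<le> cost r a {..<k} s"
    by (rule greedy_cost_le[OF assms s(1)])
  also have "\<dots> = cost r b {..<k} s"
    unfolding cost_def by (rule trimmed_sum_bij_eq[of _ id]) (auto simp: b_def)
  finally have 1: "cost r a {..<k} (a k) \<le> cost r b {..<k} s" .
  have "cost r a {..<l} (a l) \<le> cost r a {..<l} s"
    by (rule greedy_cost_le[OF assms s(1)])
  also have "\<dots> = cost r b {k..<k + l} s"
    unfolding cost_def
  proof (rule trimmed_sum_bij_eq[of _ "\<lambda>i. i + k"])
    show "bij_betw (\<lambda>i. i + k) {..<l} {k..<k + l}"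
      by (intro bij_betwI[where g = "\<lambda>i. i - k"]) auto
  qed (auto simp: b_def)
  finally have 2: "cost r a {..<l} (a l) \<le> cost r b {k..<k + l} s" .
  have "{..<k} \<union> {k..<k + l} = {..<k + l}" by auto
  then have "cost r b {..<k} s + cost r b {k..<k + l} s \<le> cost r b {..<k + l} s"
    unfolding cost_def using trimmed_sum_Un_superadditive[of "{..<k}" "{k..<k + l}" r] by (metis finite_atLeastLessThan finite_lessThan ivl_disj_int_one(2))
  then show ?thesis using add_mono[OF 1 2] s(2) by (meson order_trans)
qed

end

section \<open>The lattice of ideals\<close>

interpretation self: module "(*) :: 'a::comm_ring_1 \<Rightarrow> 'a \<Rightarrow> 'a"
  by (rule module_times)

\<comment> \<open>For scalar multiplication in the ring itself, this rule is associativity in reverse.\<close>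
declare self.scale_scale [simp del]

instantiation ideal :: (comm_ring_1) order
begin

lift_definition less_eq_ideal :: "'a ideal \<Rightarrow> 'a ideal \<Rightarrow> bool" is "(\<subseteq>)" .

definition less_ideal :: "'a ideal \<Rightarrow> 'a ideal \<Rightarrow> bool" where
  "less_ideal I J \<longleftrightarrow> I \<le> J \<and> \<not> J \<le> I"

instance
  by standard (auto simp: less_ideal_def less_eq_ideal.rep_eq elts_inject)

end

lemma subspace_elts: "self.subspace (elts I)"
  using elts[of I] by simp

lemmas elts_zero = self.subspace_0[OF subspace_elts]
  and elts_add = self.subspace_add[OF subspace_elts]
  and elts_diff = self.subspace_diff[OF subspace_elts]
  and elts_uminus = self.subspace_neg[OF subspace_elts]
  and elts_scale = self.subspace_scale[OF subspace_elts]

lemma elts_one_ideal [simp]: "elts 1 = UNIV"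
  by (rule one_ideal.rep_eq)

lemma elts_zero_ideal [simp]: "elts 0 = {0}"
  by (rule zero_ideal.rep_eq)

lemma ideal_leI: "(\<And>x. x \<in> elts I \<Longrightarrow> x \<in> elts J) \<Longrightarrow> I \<le> J"
  by (auto simp: less_eq_ideal.rep_eq)

lemma ideal_leD: "I \<le> J \<Longrightarrow> x \<in> elts I \<Longrightarrow> x \<in> elts J"
  by (auto simp: less_eq_ideal.rep_eq)

lemma ideal_le_one [simp]: "I \<le> 1" for I :: "'a::comm_ring_1 ideal"
  by (rule ideal_leI) simp

lemma zero_ideal_le [simp]: "0 \<le> I" for I :: "'a::comm_ring_1 ideal"
  by (rule ideal_leI) (simp add: elts_zero)

lemma ideal_eq_one_iff: "I = 1 \<longleftrightarrow> 1 \<in> elts I"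
proof
  assume one: "1 \<in> elts I"
  have "x \<in> elts I" for x
    using elts_scale[OF one, of x] by simp
  then show "I = 1" by (intro antisym ideal_leI) auto
qed simp

lemma times_idealI: "x \<in> elts I \<Longrightarrow> y \<in> elts J \<Longrightarrow> x * y \<in> elts (I * J)"
  unfolding times_ideal.rep_eq by (blast intro: self.span_base)

lemma times_ideal_leI:
  assumes "\<And>x y. x \<in> elts I \<Longrightarrow> y \<in> elts J \<Longrightarrow> x * y \<in> elts K"
  shows "I * J \<le> K"
  unfolding less_eq_ideal.rep_eq times_ideal.rep_eq
  using assms by (intro self.span_minimal subspace_elts) blast

lemma times_ideal_mono: "I \<le> I' \<Longrightarrow> J \<le> J' \<Longrightarrow> I * J \<le> I' * J'" for I :: "'a::comm_ring_1 ideal"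
  by (intro times_ideal_leI times_idealI) (auto dest: ideal_leD)

lemma times_ideal_le_left: "I * J \<le> I" for I :: "'a::comm_ring_1 ideal"
  using times_ideal_mono[of I I J 1] by simp

lemma times_ideal_le_right: "I * J \<le> J" for I :: "'a::comm_ring_1 ideal"
  using times_ideal_le_left[of J I] by (simp add: mult.commute)

lemma zero_times_ideal [simp]: "0 * I = 0" for I :: "'a::comm_ring_1 ideal"
  by (intro antisym times_ideal_le_left) simp

lemma power_ideal_antimono: "m \<le> n \<Longrightarrow> I ^ n \<le> I ^ m" for I :: "'a::comm_ring_1 ideal"
  by (metis le_add_diff_inverse power_add times_ideal_le_left)

lift_definition principal :: "'a::comm_ring_1 \<Rightarrow> 'a ideal" is "\<lambda>a. range (\<lambda>c. c * a)"
  unfolding self.span_singleton[symmetric] by (rule self.subspace_span)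

lift_definition adjoin :: "'a::comm_ring_1 ideal \<Rightarrow> 'a \<Rightarrow> 'a ideal"
  is "\<lambda>I x. {i + c * x |i c. i \<in> I}"
proof (rule self.subspaceI)
  fix I :: "'a set" and a :: 'a
  assume I: "self.subspace I"
  show "0 \<in> {i + c * a |i c. i \<in> I}"
    using self.subspace_0[OF I] by (auto intro!: exI[of _ 0])
  fix x assume "x \<in> {i + c * a |i c. i \<in> I}"
  then obtain i c where x: "x = i + c * a" "i \<in> I" by blast
  show "x + y \<in> {i + c * a |i c. i \<in> I}" if "y \<in> {i + c * a |i c. i \<in> I}" for y
  proof -
    from that obtain j d where y: "y = j + d * a" "j \<in> I" by blast
    have "x + y = (i + j) + (c + d) * a" by (simp add: x y algebra_simps)
    then show ?thesis using self.subspace_add[OF I x(2) y(2)] by blast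
  qed
  show "d * x \<in> {i + c * a |i c. i \<in> I}" for d
  proof -
    have "d * x = d * i + (d * c) * a" by (simp add: x algebra_simps)
    then show ?thesis using self.subspace_scale[OF I x(2)] by blast
  qed
qed

lift_definition colon :: "'a::comm_ring_1 ideal \<Rightarrow> 'a \<Rightarrow> 'a ideal" is "\<lambda>I a. {x. a * x \<in> I}"
proof (rule self.subspaceI)
  fix I :: "'a set" and a :: 'a
  assume I: "self.subspace I"
  show "0 \<in> {x. a * x \<in> I}" using self.subspace_0[OF I] by simp
  show "x + y \<in> {x. a * x \<in> I}" if "x \<in> {x. a * x \<in> I}" "y \<in> {x. a * x \<in> I}" for x y
    using self.subspace_add[OF I, of "a * x" "a * y"] that by (simp add: distrib_left)
  show "c * x \<in> {x. a * x \<in> I}" if "x \<in> {x. a * x \<in> I}" for c x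
    using self.subspace_scale[OF I, of "a * x" c] that by (simp add: mult.left_commute)
qed

lemma principal_le_iff: "principal a \<le> I \<longleftrightarrow> a \<in> elts I"
proof
  show "a \<in> elts I" if "principal a \<le> I"
    using ideal_leD[OF that, of a] rangeI[of "\<lambda>c. c * a" 1] unfolding principal.rep_eq by simp
qed (auto simp: principal.rep_eq intro!: ideal_leI elts_scale)

lemma self_in_principal: "a \<in> elts (principal a)"
  by (simp add: principal_le_iff[symmetric])

lemma in_principal_iff: "x \<in> elts (principal a) \<longleftrightarrow> a dvd x"
  by (auto simp: principal.rep_eq dvd_def mult.commute)

lemma principal_eq_0_iff: "principal a = 0 \<longleftrightarrow> a = 0"
  using principal_le_iff[of a 0] by (metis elts_zero_ideal order_antisym order_refl singletonD singletonI zero_ideal_le)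

lemma in_span_image_lessThan:
  fixes y :: "nat \<Rightarrow> 'a::comm_ring_1"
  assumes "x \<in> self.span (y ` {..<N})"
  shows "\<exists>c. x = (\<Sum>i<N. c i * y i)"
  using assms
proof (induction rule: self.span_induct_alt)
  case base
  then show ?case by (intro exI[of _ "\<lambda>_. 0"]) simp
next
  case (step d z x)
  then obtain c j where x: "x = (\<Sum>i<N. c i * y i)" and z: "z = y j" "j < N" by auto
  show ?case
    using z by (intro exI[of _ "\<lambda>i. c i + (if i = j then d else 0)"])
      (simp add: x distrib_right sum.distrib if_distrib[of "\<lambda>c. c * _"] cong: if_cong)
qed

lemma elts_principal_times: "elts (principal a * I) = (*) a ` elts I"
proof
  have "(*) a ` elts I = elts (Abs_ideal ((*) a ` elts I))"
  proof (rule Abs_ideal_inverse[symmetric], rule CollectI, rule self.subspaceI)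
    show "0 \<in> (*) a ` elts I" using elts_zero[of I] by force
    show "x + y \<in> (*) a ` elts I" if "x \<in> (*) a ` elts I" "y \<in> (*) a ` elts I" for x y
      using that elts_add[of _ I] by (auto simp: distrib_left[symmetric])
    show "c * x \<in> (*) a ` elts I" if "x \<in> (*) a ` elts I" for c x
      using that by (auto simp: mult.left_commute[of c] intro!: elts_scale)
  qed
  moreover have "principal a * I \<le> Abs_ideal ((*) a ` elts I)"
    unfolding calculation[symmetric]
  proof (rule times_ideal_leI)
    fix x y assume "x \<in> elts (principal a)" "y \<in> elts I"
    then obtain c where "x = c * a" and y: "y \<in> elts I"
      by (auto simp: principal.rep_eq)
    then have "x * y = a * (c * y)" "c * y \<in> elts I"
      by (simp_all add: mult_ac elts_scale)
    then show "x * y \<in> elts (Abs_ideal ((*) a ` elts I))"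
      unfolding calculation[symmetric] by blast
  qed
  ultimately show "elts (principal a * I) \<subseteq> (*) a ` elts I"
    by (simp add: less_eq_ideal.rep_eq)
  show "(*) a ` elts I \<subseteq> elts (principal a * I)"
    using self_in_principal by (auto intro: times_idealI)
qed

lemma principal_times_le_cancel:
  fixes a :: "'a::idom"
  assumes "a \<noteq> 0" "principal a * I \<le> principal a * J"
  shows "I \<le> J"
  using assms by (auto simp: less_eq_ideal.rep_eq elts_principal_times)

text \<open>
  For ideals inside \<open>(a)\<close>, \<open>colon I a\<close> is the quotient of \<open>I\<close> by \<open>a\<close>.  It replaces fractional ideals
  in the sequel.
\<close>

lemma principal_times_colon:
  assumes "I \<le> principal a"
  shows "principal a * colon I a = I"
proof -
  have "x \<in> (*) a ` elts (colon I a)" if "x \<in> elts I" for x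
    using ideal_leD[OF assms that] that
    by (auto simp: in_principal_iff colon.rep_eq dvd_def)
  then show ?thesis
    by (auto simp: elts_inject[symmetric] elts_principal_times colon.rep_eq)
qed

lemma le_adjoin: "I \<le> adjoin I x"
proof (rule ideal_leI)
  show "i \<in> elts (adjoin I x)" if "i \<in> elts I" for i
    unfolding adjoin.rep_eq using that by (intro CollectI exI[of _ i] exI[of _ 0]) simp
qed

lemma in_adjoin: "x \<in> elts (adjoin I x)"
  unfolding adjoin.rep_eq using elts_zero[of I] by (intro CollectI exI[of _ 0] exI[of _ 1]) simp

lemma less_adjoin: "x \<notin> elts I \<Longrightarrow> I < adjoin I x"
  using le_adjoin[of I x] in_adjoin[of x I] by (auto simp: less_ideal_def dest: ideal_leD)

lemma adjoin_times_le:
  assumes "I \<le> K" "\<And>i. i \<in> elts J \<Longrightarrow> x * i \<in> elts K" "I * J \<le> K"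
  shows "adjoin I x * J \<le> K"
proof (rule times_ideal_leI)
  fix u j assume "u \<in> elts (adjoin I x)" and j: "j \<in> elts J"
  then obtain i c where u: "u = i + c * x" "i \<in> elts I" by (auto simp: adjoin.rep_eq)
  have "u * j = i * j + c * (x * j)" by (simp add: u algebra_simps)
  moreover have "i * j \<in> elts K" using ideal_leD[OF assms(3) times_idealI[OF u(2) j]] .
  ultimately show "u * j \<in> elts K"
    using assms(2)[OF j] by (simp add: elts_add elts_scale)
qed

section \<open>Prime ideals\<close>

lemma prime_ideal_neq_one: "prime_ideal P \<Longrightarrow> P \<noteq> 1"
  by (auto simp: prime_ideal_def)

lemma prime_ideal_times_le:
  assumes "prime_ideal P" "I * J \<le> P"
  shows "I \<le> P \<or> J \<le> P"
proof (rule ccontr)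
  assume "\<not> ?thesis"
  then obtain x y where xy: "x \<in> elts I" "x \<notin> elts P" "y \<in> elts J" "y \<notin> elts P"
    by (auto simp: less_eq_ideal.rep_eq)
  then have "x * y \<in> elts P" using assms(2) times_idealI ideal_leD by blast
  then show False using xy assms(1) by (auto simp: prime_ideal_def)
qed

lemma prime_ideal_prod_mset_le:
  assumes "prime_ideal P" "prod_mset M \<le> P"
  shows "\<exists>Q\<in>#M. Q \<le> P"
  using assms(2)
proof (induction M)
  case empty
  then show ?case
    using prime_ideal_neq_one[OF assms(1)] by (simp add: antisym)
next
  case (add Q M)
  then show ?case
    using prime_ideal_times_le[OF assms(1), of Q "prod_mset M"] by auto
qed

lemma maximal_proper_is_prime:
  assumes "I \<noteq> 1" "\<And>J. I < J \<Longrightarrow> J = 1"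
  shows "prime_ideal I"
proof -
  have "y \<in> elts I" if xy: "x * y \<in> elts I" and x: "x \<notin> elts I" for x y
  proof -
    have "1 \<in> elts (adjoin I x)" using assms(2)[OF less_adjoin[OF x]] by simp
    then obtain i c where 1: "1 = i + c * x" "i \<in> elts I" by (auto simp: adjoin.rep_eq)
    have "y = (i + c * x) * y" using 1(1) by simp
    also have "\<dots> = y * i + c * (x * y)" by (simp add: algebra_simps)
    finally show ?thesis using 1(2) xy by (metis elts_add elts_scale)
  qed
  then show ?thesis using assms(1) elts_inject[of I 1] by (auto simp: prime_ideal_def)
qed

section \<open>Ideals of a Dedekind domain\<close>

context
  assumes dedekind: "dedekind_domain TYPE('a::idom)"
begin

lemma ascending_chain_stabilizes:
  fixes f :: "nat \<Rightarrow> 'a ideal"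
  assumes "mono f"
  shows "\<exists>N. \<forall>n. f n \<le> f N"
proof -
  define U where "U = (\<Union>n. elts (f n))"
  have sub: "self.subspace U"
  proof (rule self.subspaceI)
    show "0 \<in> U" by (auto simp: U_def elts_zero)
    show "x + y \<in> U" if "x \<in> U" "y \<in> U" for x y
    proof -
      from that obtain m n where "x \<in> elts (f m)" "y \<in> elts (f n)" by (auto simp: U_def)
      then have "x \<in> elts (f (max m n))" "y \<in> elts (f (max m n))"
        using monoD[OF assms] ideal_leD by (meson max.cobounded1 max.cobounded2)+
      then show ?thesis unfolding U_def using elts_add by blast
    qed
    show "c * x \<in> U" if "x \<in> U" for c x
      using that by (auto simp: U_def intro: elts_scale)
  qed
  obtain B where B: "finite B" "elts (Abs_ideal U) = self.span B"
    using dedekind unfolding dedekind_domain_def by blast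
  have U: "U = self.span B" using B(2) sub by (simp add: Abs_ideal_inverse)
  have "\<exists>N. B \<subseteq> elts (f N)" if "finite B" "B \<subseteq> U" for B
    using that
  proof (induction B)
    case empty
    then show ?case by simp
  next
    case (insert x B)
    then obtain N n where "B \<subseteq> elts (f N)" "x \<in> elts (f n)" by (auto simp: U_def)
    then have "insert x B \<subseteq> elts (f (max n N))"
      using monoD[OF assms, of n "max n N"] monoD[OF assms, of N "max n N"]
      by (auto simp: less_eq_ideal.rep_eq)
    then show ?case by blast
  qed
  then obtain N where "B \<subseteq> elts (f N)" using B(1) U self.span_superset by blast
  then have "U \<subseteq> elts (f N)" unfolding U by (intro self.span_minimal subspace_elts)
  then show ?thesis unfolding U_def less_eq_ideal.rep_eq by blast
qed

lemma wf_greater_ideal: "wf {(J, I). I < (J :: 'a ideal)}"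
  unfolding wf_iff_no_infinite_down_chain
proof
  assume "\<exists>f. \<forall>i. (f (Suc i), f i) \<in> {(J, I). I < (J :: 'a ideal)}"
  then obtain f :: "nat \<Rightarrow> 'a ideal" where f: "\<And>i. f i < f (Suc i)" by auto
  then have "mono f" by (simp add: mono_iff_le_Suc less_imp_le)
  from ascending_chain_stabilizes[OF this] obtain N where "f (Suc N) \<le> f N" by blast
  then show False using f[of N] by simp
qed

lemmas noetherian_induct = wf_induct_rule[OF wf_greater_ideal, simplified, case_names greater]

lemma prime_ideal_maximal:
  fixes P J :: "'a ideal"
  assumes "prime_ideal P" "P \<noteq> 0" "P \<le> J"
  shows "J = P \<or> J = 1"
proof -
  have "maximal_ideal P" using dedekind assms(1,2) unfolding dedekind_domain_def by blast
  then have "J = P \<or> elts J = UNIV"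
    using assms(3) unfolding maximal_ideal_def less_eq_ideal.rep_eq by blast
  then show ?thesis by (auto simp: ideal_eq_one_iff)
qed

lemma proper_le_prime_ideal:
  fixes I :: "'a ideal"
  assumes "I \<noteq> 1"
  shows "\<exists>P. prime_ideal P \<and> I \<le> P"
  using assms
proof (induction I rule: noetherian_induct)
  case (greater I)
  then show ?case
    using maximal_proper_is_prime[of I] by (meson less_imp_le order_refl order_trans)
qed

text \<open>
  A non-prime proper ideal \<open>I\<close> contains the product of two strictly larger ideals, obtained by adjoining
  \<open>x\<close> and \<open>y\<close> with \<open>x * y \<in> I\<close>.
\<close>

lemma contains_prime_product:
  fixes I :: "'a ideal"
  assumes "I \<noteq> 0"
  shows "\<exists>M. (\<forall>P\<in>#M. prime_ideal P \<and> P \<noteq> 0) \<and> prod_mset M \<le> I"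
  using assms
proof (induction I rule: noetherian_induct)
  case (greater I)
  consider "I = 1" | "prime_ideal I" | "I \<noteq> 1" "\<not> prime_ideal I" by blast
  then show ?case
  proof cases
    case 1
    then show ?thesis by (intro exI[of _ "{#}"]) simp
  next
    case 2
    then show ?thesis using greater.prems by (intro exI[of _ "{#I#}"]) simp
  next
    case 3
    then obtain x y where xy: "x * y \<in> elts I" "x \<notin> elts I" "y \<notin> elts I"
      using elts_inject[of I 1] by (auto simp: prime_ideal_def)
    have above: "\<exists>M. (\<forall>P\<in>#M. prime_ideal P \<and> P \<noteq> 0) \<and> prod_mset M \<le> adjoin I z"
      if "z \<notin> elts I" for z
      using greater.IH[OF less_adjoin[OF that]] greater.prems less_adjoin[OF that]
      by (metis less_imp_le order_antisym zero_ideal_le)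
    obtain M N where M: "\<forall>P\<in>#M. prime_ideal P \<and> P \<noteq> 0" "prod_mset M \<le> adjoin I x"
      and N: "\<forall>P\<in>#N. prime_ideal P \<and> P \<noteq> 0" "prod_mset N \<le> adjoin I y"
      using above[OF xy(2)] above[OF xy(3)] by blast
    have "adjoin I y * principal x \<le> I"
      using xy(1) by (intro adjoin_times_le times_ideal_le_left)
        (auto simp: principal.rep_eq mult_ac dest: elts_scale)
    then have "x * i \<in> elts I" if "i \<in> elts (adjoin I y)" for i
      using ideal_leD times_idealI[OF that self_in_principal[of x]] by (metis mult.commute)
    then have "adjoin I x * adjoin I y \<le> I"
      by (intro adjoin_times_le times_ideal_le_left) auto
    then have "prod_mset (M + N) \<le> I"
      using times_ideal_mono[OF M(2) N(2)] by simp
    then show ?thesis using M(1) N(1) by (intro exI[of _ "M + N"]) auto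
  qed
qed

text \<open>
  Integral closedness in the form used here: if \<open>b I \<subseteq> a I\<close>, the fraction \<open>x = b / a\<close> maps \<open>I\<close> into itself,
  so all \<open>x ^ n * i0\<close> with a fixed \<open>i0 \<in> I\<close> stay in the domain.  The ideals generated by the
  first \<open>N\<close> of them stabilize, which expresses some \<open>x ^ N\<close> by lower powers.  This use of the ascending
  chain condition takes the place of the determinant argument.
\<close>

lemma multiplier_integral:
  fixes I :: "'a ideal"
  assumes "I \<noteq> 0" "a \<noteq> 0" and mult: "\<And>i. i \<in> elts I \<Longrightarrow> b * i \<in> elts (principal a * I)"
  shows "a dvd b"
proof -
  obtain i0 where i0: "i0 \<in> elts I" "i0 \<noteq> 0"
    using assms(1) elts_zero[of I] by (metis ideal_leI order_antisym elts_zero_ideal singletonI zero_ideal_le)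
  have "\<exists>y\<in>elts I. b ^ n * i0 = a ^ n * y" for n
  proof (induction n)
    case 0
    then show ?case using i0 by simp
  next
    case (Suc n)
    then obtain y where y: "y \<in> elts I" "b ^ n * i0 = a ^ n * y" by blast
    obtain z where z: "z \<in> elts I" "b * y = a * z"
      using mult[OF y(1)] by (auto simp: elts_principal_times)
    have "b ^ Suc n * i0 = b * (b ^ n * i0)" by (simp add: mult.assoc)
    also have "\<dots> = a ^ n * (b * y)" unfolding y(2) by (rule mult.left_commute)
    also have "\<dots> = a ^ Suc n * z" unfolding z(2) by (simp add: mult_ac)
    finally show ?case using z(1) by (rule bexI)
  qed
  then have "\<forall>n. \<exists>y. b ^ n * i0 = a ^ n * y" by blast
  then obtain y where y: "\<And>n. b ^ n * i0 = a ^ n * y n" unfolding choice_iff by blast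
  define x where "x = to_fract b / to_fract a"
  have to_fract_power: "to_fract (u ^ n) = to_fract u ^ n" for u :: 'a and n
    by (induction n) simp_all
  have y_eq: "to_fract (y n) = x ^ n * to_fract i0" for n
  proof -
    have "to_fract b ^ n * to_fract i0 = to_fract a ^ n * to_fract (y n)"
      using arg_cong[OF y[of n], of to_fract] by (simp add: to_fract_power)
    then show ?thesis
      using assms(2) by (simp add: x_def power_divide field_simps)
  qed
  define f where "f n = Abs_ideal (self.span (y ` {..<n}))" for n
  have f: "elts (f n) = self.span (y ` {..<n})" for n
    unfolding f_def by (rule Abs_ideal_inverse) simp
  have "mono f"
    by (intro monoI ideal_leI) (auto simp: f intro: self.span_mono[THEN subsetD, rotated])
  then obtain N where "f (Suc N) \<le> f N" using ascending_chain_stabilizes by blast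
  then have "y N \<in> self.span (y ` {..<N})"
    unfolding less_eq_ideal.rep_eq f by (auto intro: self.span_base)
  then obtain c where c: "y N = (\<Sum>i<N. c i * y i)" using in_span_image_lessThan by blast
  have "x ^ N * to_fract i0 = (\<Sum>i<N. to_fract (c i) * x ^ i) * to_fract i0"
    using arg_cong[OF c, of to_fract] by (simp add: y_eq sum_distrib_right mult.assoc)
  then have xN: "x ^ N = (\<Sum>i<N. to_fract (c i) * x ^ i)" using i0(2) by simp
  define p where "p = Poly (map (\<lambda>i. - c i) [0..<N] @ [1])"
  have coeff_p: "coeff p i = (if i < N then - c i else if i = N then 1 else 0)" for i
    by (simp add: p_def coeff_Poly_eq nth_default_def nth_append)
  have deg: "degree p = N"
    by (rule antisym[OF degree_le le_degree]) (auto simp: coeff_p)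
  have "poly (map_poly to_fract p) x = (\<Sum>i\<le>N. to_fract (coeff p i) * x ^ i)"
    by (simp add: poly_altdef coeff_map_poly degree_map_poly deg)
  also have "\<dots> = (\<Sum>i<N. - (to_fract (c i) * x ^ i)) + x ^ N"
    by (simp add: lessThan_Suc_atMost[symmetric] coeff_p)
  also have "\<dots> = 0" by (simp add: sum_negf xN)
  finally have "poly (map_poly to_fract p) x = 0" .
  moreover have "lead_coeff p = 1" by (simp add: deg coeff_p)
  ultimately obtain d where "x = to_fract d"
    using dedekind unfolding dedekind_domain_def by blast
  then have "to_fract b = to_fract (a * d)" using assms(2) by (simp add: x_def field_simps)
  then show ?thesis by (simp only: to_fract_eq_iff) simp
qed

text \<open>
  Take a nonzero \<open>a \<in> P\<close> and a product of as few primes as possible inside \<open>(a)\<close>.  By maximality \<open>P\<close> is among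
  the factors, and the product of the others contains some \<open>b \<notin> (a)\<close> with \<open>b P \<subseteq> (a)\<close>.  For \<open>Q = (a, b)\<close> the ideal
  \<open>P Q\<close> is \<open>(a)\<close> times an ideal between \<open>P\<close> and the unit ideal; if that were \<open>P\<close>, then \<open>b / a\<close> would be
  integral and \<open>b\<close> would lie in \<open>(a)\<close>.
\<close>

lemma prime_ideal_invertible:
  fixes P :: "'a ideal"
  assumes P: "prime_ideal P" "P \<noteq> 0"
  shows "\<exists>a Q. a \<noteq> 0 \<and> P * Q = principal a"
proof -
  obtain a where a: "a \<in> elts P" "a \<noteq> 0"
    using P(2) elts_zero[of P] by (metis ideal_leI order_antisym elts_zero_ideal singletonI zero_ideal_le)
  define good where "good M \<longleftrightarrow> (\<forall>Q\<in>#M. prime_ideal Q \<and> Q \<noteq> 0) \<and> prod_mset M \<le> principal a" for M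
  have "\<exists>M. good M"
    unfolding good_def using a(2) by (intro contains_prime_product) (simp add: principal_eq_0_iff)
  then obtain M where M: "good M" and min: "\<And>N. good N \<Longrightarrow> size M \<le> size N"
    using ex_has_least_nat[of good _ size] by blast
  have "prod_mset M \<le> P"
    using M a(1) principal_le_iff order_trans unfolding good_def by blast
  then obtain Q where "Q \<in># M" "Q \<le> P" using prime_ideal_prod_mset_le[OF P(1)] by blast
  then have "P \<in># M"
    using M prime_ideal_maximal[of Q P] prime_ideal_neq_one[OF P(1)] unfolding good_def by blast
  then obtain N where N: "M = add_mset P N" by (meson mset_add)
  have "\<not> good N" using min[of N] N by auto
  then have "\<not> prod_mset N \<le> principal a" using M N by (auto simp: good_def)
  then obtain b where b: "b \<in> elts (prod_mset N)" "b \<notin> elts (principal a)"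
    by (auto simp: less_eq_ideal.rep_eq)
  have bp: "b * p \<in> elts (principal a)" if "p \<in> elts P" for p
    using times_idealI[OF that b(1)] M N by (auto simp: good_def mult.commute dest: ideal_leD)
  define Q where "Q = adjoin (principal a) b"
  have "Q * P \<le> principal a"
    unfolding Q_def using bp by (intro adjoin_times_le times_ideal_le_left) auto
  then have le: "P * Q \<le> principal a" by (simp add: mult.commute)
  have Q: "a \<in> elts Q" "b \<in> elts Q"
    using ideal_leD[OF le_adjoin self_in_principal] in_adjoin by (simp_all add: Q_def)
  have "P \<le> colon (P * Q) a"
    using times_idealI[OF _ Q(1)] by (intro ideal_leI) (simp add: colon.rep_eq mult.commute)
  then consider "colon (P * Q) a = P" | "colon (P * Q) a = 1"
    using prime_ideal_maximal[OF P] by blast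
  then have "P * Q = principal a"
  proof cases
    case 1
    then have "principal a * P = P * Q" using principal_times_colon[OF le] by simp
    then have "b * i \<in> elts (principal a * P)" if "i \<in> elts P" for i
      using times_idealI[OF that Q(2)] by (simp add: mult.commute)
    then have "a dvd b" by (rule multiplier_integral[OF P(2) a(2)])
    then show ?thesis using b(2) by (simp add: in_principal_iff)
  next
    case 2
    then show ?thesis using principal_times_colon[OF le] by simp
  qed
  then show ?thesis using a(2) by blast
qed

lemma finite_prime_ideals_above:
  fixes I :: "'a ideal"
  assumes "I \<noteq> 0"
  shows "finite {P. prime_ideal P \<and> I \<le> P}"
proof -
  obtain M where M: "\<forall>P\<in>#M. prime_ideal P \<and> P \<noteq> 0" "prod_mset M \<le> I"
    using contains_prime_product[OF assms] by blast
  have "P \<in># M" if P: "prime_ideal P" "I \<le> P" for P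
  proof -
    obtain Q where "Q \<in># M" "Q \<le> P"
      using prime_ideal_prod_mset_le[OF P(1)] M(2) P(2) by (meson order_trans)
    then show ?thesis
      using M(1) prime_ideal_maximal[of Q P] prime_ideal_neq_one[OF P(1)] by blast
  qed
  then have "{P. prime_ideal P \<and> I \<le> P} \<subseteq> set_mset M" by blast
  then show ?thesis by (rule finite_subset) simp
qed

text \<open>
  With \<open>P Q = (a)\<close>, the ideal \<open>q J = (J Q : a)\<close> is the quotient of \<open>J\<close> by \<open>P\<close>.  It is strictly
  larger than \<open>J\<close> for \<open>J = I\<close>, since otherwise \<open>Q\<close> would multiply \<open>I\<close> into \<open>a I\<close>, hence be contained in
  \<open>(a)\<close> by integrality, and \<open>P\<close> would be the unit ideal.
\<close>

lemma divide_by_prime_ideal: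
  fixes P I :: "'a ideal"
  assumes P: "prime_ideal P" "I \<le> P" and "I \<noteq> 0"
  shows "\<exists>I'. I < I' \<and> {J. I \<le> J \<and> J \<le> P} \<subseteq> (*) P ` {J. I' \<le> J}"
proof -
  have "P \<noteq> 0" using P(2) assms(3) by (metis order_antisym zero_ideal_le)
  then obtain a Q where a: "a \<noteq> 0" and PQ: "P * Q = principal a"
    using prime_ideal_invertible[OF P(1)] by blast
  define q where "q J = colon (J * Q) a" for J
  have aq: "principal a * q J = J * Q" if "J \<le> P" for J
    unfolding q_def using times_ideal_mono[OF that order_refl, of Q] PQ
    by (intro principal_times_colon) simp
  have Pq: "P * q J = J" if "J \<le> P" for J
  proof -
    have "principal a * (P * q J) = P * (principal a * q J)" by (simp only: mult.left_commute)
    also have "\<dots> = J * (P * Q)" by (simp add: aq[OF that] mult.left_commute)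
    finally have "principal a * (P * q J) = principal a * J" by (simp add: PQ mult.commute)
    then show ?thesis
      using principal_times_le_cancel[OF a, of "P * q J" J] principal_times_le_cancel[OF a, of J "P * q J"]
      by (intro antisym) simp_all
  qed
  have "q I \<noteq> I"
  proof
    assume "q I = I"
    then have "b * i \<in> elts (principal a * I)" if "b \<in> elts Q" "i \<in> elts I" for b i
      using times_idealI[OF that(2,1)] aq[OF P(2)] by (simp add: mult.commute)
    then have "Q \<le> principal a"
      using multiplier_integral[OF assms(3) a] by (intro ideal_leI) (auto simp: in_principal_iff)
    then have "principal a * 1 \<le> principal a * P"
      using times_ideal_mono[of P P Q "principal a"] PQ by (simp add: mult.commute)
    then have "1 \<le> P" by (rule principal_times_le_cancel[OF a])
    then show False using prime_ideal_neq_one[OF P(1)] by (simp add: antisym)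
  qed
  moreover have "I \<le> q I" using Pq[OF P(2)] times_ideal_le_right[of P "q I"] by simp
  moreover have "q I \<le> q J" if "I \<le> J" for J
    unfolding q_def using times_ideal_mono[OF that order_refl, of Q]
    by (auto simp: less_eq_ideal.rep_eq colon.rep_eq)
  ultimately show ?thesis
    using Pq by (intro exI[of _ "q I"]) (force simp: image_iff less_le)
qed

text \<open>
  A proper ideal above \<open>I\<close> lies in one of finitely many primes \<open>P\<close> above \<open>I\<close>, and dividing by \<open>P\<close> maps the
  ideals between \<open>I\<close> and \<open>P\<close> injectively to ideals above a strictly larger ideal.
\<close>

theorem finite_ideals_above:
  fixes I :: "'a ideal"
  assumes "I \<noteq> 0"
  shows "finite {J. I \<le> J}"
  using assms
proof (induction I rule: noetherian_induct)
  case (greater I)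
  have fin: "finite {J. I \<le> J \<and> J \<le> P}" if P: "prime_ideal P" "I \<le> P" for P
  proof -
    obtain I' where I': "I < I'" "{J. I \<le> J \<and> J \<le> P} \<subseteq> (*) P ` {J. I' \<le> J}"
      using divide_by_prime_ideal[OF P greater.prems] by blast
    have "I' \<noteq> 0" using I'(1) by (metis leD zero_ideal_le)
    then have "finite {J. I' \<le> J}" by (rule greater.IH[OF I'(1)])
    then show ?thesis using I'(2) finite_subset by blast
  qed
  have "{J. I \<le> J} \<subseteq> {1} \<union> (\<Union>P\<in>{P. prime_ideal P \<and> I \<le> P}. {J. I \<le> J \<and> J \<le> P})"
    using proper_le_prime_ideal by (auto, meson order_trans)
  moreover have "finite \<dots>"
    using finite_prime_ideals_above[OF greater.prems] fin by auto
  ultimately show ?case by (rule finite_subset)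
qed

end

section \<open>The numbers alpha\<close>

lemma in_ideal_power_iff: "enat k \<le> ideal_val b x \<longleftrightarrow> x \<in> elts (b ^ k)"
proof -
  have member: "range ((*) x) \<subseteq> elts (b ^ j) \<longleftrightarrow> x \<in> elts (b ^ j)" for j
    using elts_scale[of x "b ^ j"] rangeI[of "(*) x" 1] by (auto simp: mult.commute)
  show ?thesis
  proof
    show "enat k \<le> ideal_val b x" if "x \<in> elts (b ^ k)"
      unfolding ideal_val_def member using that by (intro Sup_upper) blast
    assume le: "enat k \<le> ideal_val b x"
    show "x \<in> elts (b ^ k)"
    proof (cases k)
      case 0
      then show ?thesis by simp
    next
      case (Suc m)
      then have "enat m < Sup {enat j |j. x \<in> elts (b ^ j)}"
        using le unfolding ideal_val_def member by (simp add: Suc_ile_eq)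
      then obtain j where "x \<in> elts (b ^ j)" "m < j" by (auto simp: less_Sup_iff)
      then show ?thesis
        using power_ideal_antimono[of k j b] Suc by (auto dest: ideal_leD)
    qed
  qed
qed

lemma enat_leI: "x \<le> y" if "\<And>k. enat k \<le> x \<Longrightarrow> enat k \<le> y" for x y :: enat
proof (cases x)
  case (enat n)
  then show ?thesis using that[of n] by simp
next
  case infinity
  then show ?thesis using that[of "Suc (the_enat y)"] by (cases y) auto
qed

lemma ideal_val_eq_0: "x \<notin> elts b \<Longrightarrow> ideal_val b x = 0"
  using in_ideal_power_iff[of 1 b x] by (cases "ideal_val b x") (auto simp: zero_enat_def one_enat_def)

abbreviation trunc_val :: "enat \<Rightarrow> 'a::comm_ring_1 ideal \<Rightarrow> 'a \<Rightarrow> 'a \<Rightarrow> enat" where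
  "trunc_val h b \<equiv> \<lambda>x y. min h (ideal_val b (x - y))"

lemma ultrametric_trunc_val: "ultrametric (trunc_val h b)"
proof
  show "trunc_val h b x y = trunc_val h b y x" for x y
  proof -
    have "ideal_val b (u - v) \<le> ideal_val b (v - u)" for u v
      by (rule enat_leI) (use elts_uminus[of "u - v"] in \<open>auto simp: in_ideal_power_iff\<close>)
    then have "ideal_val b (x - y) = ideal_val b (y - x)" by (intro antisym)
    then show ?thesis by simp
  qed
  show "min (trunc_val h b x y) (trunc_val h b y z) \<le> trunc_val h b x z" for x y z
  proof -
    have "min (ideal_val b (x - y)) (ideal_val b (y - z)) \<le> ideal_val b (x - z)"
    proof (rule enat_leI)
      fix k assume "enat k \<le> min (ideal_val b (x - y)) (ideal_val b (y - z))"
      then have "(x - y) + (y - z) \<in> elts (b ^ k)"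
        unfolding min.bounded_iff in_ideal_power_iff by (intro elts_add) simp_all
      then show "enat k \<le> ideal_val b (x - z)" by (simp add: in_ideal_power_iff)
    qed
    then show ?thesis by (auto simp: min_def split: if_splits)
  qed
qed

lemma removed_sum_eq_cost:
  "removed_sum h r b a n s = ultrametric.cost (trunc_val h b) r a {..<n} s"
  by (simp add: removed_sum_def ultrametric.cost_def[OF ultrametric_trunc_val] trimmed_sum_def)

lemma removed_ordering_iff_greedy:
  "removed_ordering h r S b a \<longleftrightarrow> ultrametric.greedy (trunc_val h b) r S a"
  by (simp add: removed_ordering_def ultrametric.greedy_def[OF ultrametric_trunc_val]
      removed_sum_eq_cost)

lemma alpha_eq_alpha_seq:
  assumes "removed_ordering h r S b a"
  shows "alpha h r S b n = alpha_seq h r b a n"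
  unfolding alpha_def
proof (rule the_equality)
  show "\<exists>a'. removed_ordering h r S b a' \<and> alpha_seq h r b a n = alpha_seq h r b a' n"
    using assms by blast
  show "x = alpha_seq h r b a n" if "\<exists>a'. removed_ordering h r S b a' \<and> x = alpha_seq h r b a' n" for x
    using that assms ultrametric.greedy_cost_unique[OF ultrametric_trunc_val]
    unfolding removed_ordering_iff_greedy alpha_seq_def removed_sum_eq_cost by blast
qed

lemma removed_ordering_exists:
  "S \<noteq> {} \<Longrightarrow> \<exists>a. removed_ordering h r S b a"
  unfolding removed_ordering_iff_greedy
  by (rule ultrametric.greedy_exists[OF ultrametric_trunc_val])

lemma alpha_superadditive:
  assumes "S \<noteq> {}"
  shows "alpha h r S b k + alpha h r S b l \<le> alpha h r S b (k + l)"
proof -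
  obtain a where a: "removed_ordering h r S b a"
    using removed_ordering_exists[OF assms] by blast
  then show ?thesis
    using ultrametric.greedy_cost_superadditive[OF ultrametric_trunc_val]
    unfolding alpha_eq_alpha_seq[OF a] alpha_seq_def removed_sum_eq_cost removed_ordering_iff_greedy
    by blast
qed

text \<open>
  If \<open>S\<close> has more than \<open>n\<close> elements that are distinct modulo \<open>b\<close>, one of them is incongruent to the first
  \<open>n\<close> terms of an ordering.
\<close>

lemma alpha_eq_0:
  assumes T: "finite T" "T \<subseteq> S" "n < card T"
    and distinct: "\<And>x y. x \<in> T \<Longrightarrow> y \<in> T \<Longrightarrow> x \<noteq> y \<Longrightarrow> x - y \<notin> elts b"
  shows "alpha h r S b n = 0"
proof -
  have "S \<noteq> {}" using T by auto
  then obtain a where a: "removed_ordering h r S b a"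
    using removed_ordering_exists by blast
  have "\<exists>s\<in>T. \<forall>i<n. s - a i \<notin> elts b"
  proof (rule ccontr)
    assume "\<not> ?thesis"
    then obtain f where f: "\<And>s. s \<in> T \<Longrightarrow> f s < n \<and> s - a (f s) \<in> elts b" by metis
    have "card (f ` T) \<le> card {..<n}" using f by (intro card_mono) auto
    then have "\<not> inj_on f T" using T(3) card_image[of f T] by auto
    then obtain x y where xy: "x \<in> T" "y \<in> T" "x \<noteq> y" "f x = f y" by (auto simp: inj_on_def)
    have "(x - a (f x)) - (y - a (f y)) \<in> elts b" 
      using f[OF xy(1)] f[OF xy(2)] by (meson elts_diff)
    then show False using distinct[OF xy(1-3)] xy(4) by simp
  qed
  then obtain s where s: "s \<in> T" "\<forall>i<n. s - a i \<notin> elts b" by blast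
  have "removed_sum h r b a n s \<le> (\<Sum>i<n. trunc_val h b s (a i))"
    unfolding removed_sum_eq_cost ultrametric.cost_def[OF ultrametric_trunc_val]
    by (intro trimmed_sum_le_sum) auto
  also have "\<dots> = 0" using s(2) by (simp add: ideal_val_eq_0)
  finally have "removed_sum h r b a n s = 0" by simp
  moreover have "removed_sum h r b a n (a n) \<le> removed_sum h r b a n s"
    using a s(1) T(2) ultrametric.greedy_cost_le[OF ultrametric_trunc_val]
    unfolding removed_ordering_iff_greedy removed_sum_eq_cost by blast
  ultimately show ?thesis
    unfolding alpha_eq_alpha_seq[OF a] alpha_seq_def by simp
qed

section \<open>Divisibility of factorials\<close>

lemma dvd_ideal_imp_le: "I dvd J \<Longrightarrow> J \<le> I" for I J :: "'a::comm_ring_1 ideal"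
  by (auto simp: dvd_def times_ideal_le_left)

lemma ideal_epow_times_dvd:
  assumes "x + y \<le> z"
  shows "ideal_epow b x * ideal_epow b y dvd ideal_epow b z"
proof (cases "b = 1")
  case True
  then show ?thesis by (auto simp: ideal_epow_def split: enat.split)
next
  case False
  show ?thesis
  proof (cases z)
    case infinity
    then have "ideal_epow b z = ideal_epow b x * ideal_epow b y * 0"
      using False by (simp add: ideal_epow_def mult.commute)
    then show ?thesis by (rule dvdI)
  next
    case (enat n)
    then obtain i j where ij: "x = enat i" "y = enat j" "i + j \<le> n"
      using assms by (cases x; cases y) auto
    then have "ideal_epow b z = ideal_epow b x * ideal_epow b y * b ^ (n - (i + j))"
      using enat by (simp add: ideal_epow_def power_add[symmetric])
    then show ?thesis by (rule dvdI)
  qed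
qed

text \<open>
  Let \<open>d\<close> be the product of the differences of \<open>n + 1\<close> elements of \<open>S\<close>.  If an ideal does not contain \<open>d\<close>, these
  elements are distinct modulo the ideal and its exponent vanishes; only finitely many ideals contain
  \<open>d \<noteq> 0\<close>.
\<close>

lemma finite_nontrivial_factors:
  fixes S :: "'a::idom set"
  assumes "dedekind_domain TYPE('a)" and card: "finite S \<longrightarrow> n < card S"
  shows "finite {b. ideal_epow b (alpha h r S b n) \<noteq> 1}"
proof -
  obtain T where T: "finite T" "T \<subseteq> S" "card T = Suc n"
  proof (cases "finite S")
    case True
    then have "Suc n \<le> card S" using card by simp
    then show ?thesis using obtain_subset_with_card_n that by metis
  next
    case False
    then show ?thesis using infinite_arbitrarily_large that by metis
  qed
  define Q where "Q = {(x, y) \<in> T \<times> T. x \<noteq> y}"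
  define d where "d = (\<Prod>(x, y)\<in>Q. x - y)"
  have finQ: "finite Q" unfolding Q_def using T(1) by (auto intro: finite_subset[of _ "T \<times> T"])
  then have "d \<noteq> 0" by (auto simp: d_def Q_def)
  then have fin: "finite {J. principal d \<le> J}"
    using finite_ideals_above[OF assms(1)] by (simp add: principal_eq_0_iff)
  have "principal d \<le> b" if "ideal_epow b (alpha h r S b n) \<noteq> 1" for b
  proof -
    have "alpha h r S b n \<noteq> 0"
      using that by (auto simp: ideal_epow_def zero_enat_def)
    then obtain x y where xy: "x \<in> T" "y \<in> T" "x \<noteq> y" "x - y \<in> elts b"
      using alpha_eq_0[of T S n b h r] T by auto
    then have "(x, y) \<in> Q" by (simp add: Q_def)
    then have "x - y dvd d" unfolding d_def using dvd_prodI[OF finQ, of "(x, y)" "\<lambda>(x, y). x - y"] by simp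
    then show ?thesis using xy(4) by (auto simp: principal_le_iff dvd_def mult.commute intro: elts_scale)
  qed
  then have "{b. ideal_epow b (alpha h r S b n) \<noteq> 1} \<subseteq> {J. principal d \<le> J}" by blast
  then show ?thesis using fin by (rule finite_subset)
qed

lemma gen_fact_eq_prod:
  assumes "finite F" "F \<subseteq> \<T>" "\<And>b. b \<in> \<T> \<Longrightarrow> b \<notin> F \<Longrightarrow> ideal_epow b (alpha h r S b k) = 1"
  shows "gen_fact h r S \<T> k = (\<Prod>b\<in>F. ideal_epow b (alpha h r S b k))"
  unfolding gen_fact_def using assms by (intro prod.mono_neutral_left) auto

text \<open>
  The factors with trivial contribution to the larger factorial are trivial in the smaller
  ones too, so all three factorials are products over the same finite set of ideals, where the
  divisibility holds factor by factor.
\<close>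

lemma gen_fact_times_dvd:
  fixes S :: "'a::idom set"
  assumes "dedekind_domain TYPE('a)" "S \<noteq> {}" "finite S \<longrightarrow> k + l < card S"
  shows "gen_fact h r S \<T> k * gen_fact h r S \<T> l dvd gen_fact h r S \<T> (k + l)"
proof -
  define E where "E n b = ideal_epow b (alpha h r S b n)" for n b
  define F where "F = {b \<in> \<T>. E (k + l) b \<noteq> 1}"
  have fin: "finite F"
    using finite_nontrivial_factors[OF assms(1,3), of h r] by (simp add: F_def E_def)
  have dvd: "E k b * E l b dvd E (k + l) b" for b
    unfolding E_def by (rule ideal_epow_times_dvd[OF alpha_superadditive[OF assms(2)]])
  have trivial: "E k b = 1" "E l b = 1" if "E (k + l) b = 1" for b
  proof -
    have "1 \<le> E k b * E l b" using dvd_ideal_imp_le[OF dvd[of b]] that by simp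
    then have "1 \<le> E k b" "1 \<le> E l b"
      using times_ideal_le_left times_ideal_le_right order_trans by metis+
    then show "E k b = 1" "E l b = 1" by (simp_all add: antisym)
  qed
  have fact: "gen_fact h r S \<T> n = (\<Prod>b\<in>F. E n b)" if "n \<in> {k, l, k + l}" for n
    unfolding E_def
  proof (rule gen_fact_eq_prod[OF fin])
    show "ideal_epow b (alpha h r S b n) = 1" if "b \<in> \<T>" "b \<notin> F" for b
      using that \<open>n \<in> {k, l, k + l}\<close> trivial[of b] by (auto simp: F_def E_def)
  qed (auto simp: F_def)
  obtain c where "\<And>b. E (k + l) b = E k b * E l b * c b"
    using dvd unfolding dvd_def by metis
  then have "gen_fact h r S \<T> (k + l) = gen_fact h r S \<T> k * gen_fact h r S \<T> l * (\<Prod>b\<in>F. c b)"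
    by (simp add: fact prod.distrib)
  then show ?thesis by (rule dvdI)
qed

text \<open>
  Every product of an element of \<open>I\<close> with an element of the inverse of \<open>J\<close> lies in the domain simply because
  \<open>I \<subseteq> J\<close>, so the fractional ideal is a submodule of the domain.
\<close>

lemma integral_quotient:
  fixes I J :: "'a::idom ideal"
  assumes "I \<le> J"
  shows "integral_ideal (frac_times (frac_of_ideal I) (frac_inverse (frac_of_ideal J)))"
proof -
  interpret M: module "\<lambda>(d::'a) x. to_fract d * x"
    by unfold_locales (simp_all add: algebra_simps)
  define X where "X = frac_times (frac_of_ideal I) (frac_inverse (frac_of_ideal J))"
  have sub: "M.subspace X" unfolding X_def frac_times_def by (rule M.subspace_span)
  have "M.subspace (range to_fract)"
  proof (rule M.subspaceI)
    show "0 \<in> range to_fract" by (rule range_eqI[of _ _ 0]) simp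
    show "x + y \<in> range to_fract" if "x \<in> range to_fract" "y \<in> range to_fract" for x y :: "'a fract"
      using that by (auto simp: to_fract_add[symmetric] simp del: to_fract_add)
    show "to_fract c * x \<in> range to_fract" if "x \<in> range to_fract" for c and x :: "'a fract"
      using that by (auto simp: to_fract_mult[symmetric] simp del: to_fract_mult)
  qed
  moreover have "x * y \<in> range to_fract"
    if "x \<in> frac_of_ideal I" "y \<in> frac_inverse (frac_of_ideal J)" for x y
    using that ideal_leD[OF assms] by (auto simp: frac_of_ideal_def frac_inverse_def mult.commute[of x])
  ultimately have X: "X \<subseteq> range to_fract"
    unfolding X_def frac_times_def by (intro M.span_minimal) auto
  have "self.subspace (to_fract -` X)"
    using M.subspace_0[OF sub] M.subspace_add[OF sub] M.subspace_scale[OF sub]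
    by (intro self.subspaceI) auto
  then have "elts (Abs_ideal (to_fract -` X)) = to_fract -` X" by (simp add: Abs_ideal_inverse)
  then have "X = frac_of_ideal (Abs_ideal (to_fract -` X))"
    using X by (auto simp: frac_of_ideal_def)
  then show ?thesis unfolding integral_ideal_def X_def by blast
qed

theorem theorem3p13:
  fixes S :: "'a::idom set" and \<T> :: "'a ideal set"
    and h :: enat and r k l :: nat
  assumes "dedekind_domain TYPE('a)"
    and "S \<noteq> {}"
    and "finite S \<longrightarrow> k + l < card S"
  shows "integral_ideal (gen_binom h r S \<T> (k + l) l) \<and>
         gen_fact h r S \<T> k * gen_fact h r S \<T> l dvd gen_fact h r S \<T> (k + l)"
proof
  show dvd: "gen_fact h r S \<T> k * gen_fact h r S \<T> l dvd gen_fact h r S \<T> (k + l)"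
    by (rule gen_fact_times_dvd[OF assms])
  show "integral_ideal (gen_binom h r S \<T> (k + l) l)"
    unfolding gen_binom_def using integral_quotient[OF dvd_ideal_imp_le[OF dvd]] by simp
qed

end
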